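(* For all non-negative integers $m$ and $n$, the quantity $2^{m}\cdot B_{m,n}(-n/2)$ equals the number $T_{m+n,n}$ of set partitions of a set of cardinality $m+n$ into $n$ blocks, all of odd size.
   Context: For non-negative integers $m,n$, the box polynomial is $$B_{m,n}(x)=\sum_{\lambda\subseteq m\times n}\ \prod_{i=1}^{m}(x+\lambda_i),$$ where the sum is over all integer sequences (partitions) $\lambda=(n\ge\lambda_1\ge\lambda_2\ge\cdots\ge\lambda_m\ge 0)$, i.e. partitions with $m$ non-negative parts, each at most $n$ (an empty product is $1$). *)

theory Defs
  imports Complex_Main "HOL-Computational_Algebra.Polynomial" "HOL-Library.Disjoint_Sets"
begin

text \<open>The partition \<open>\<lambda>\<^sub>1 \<ge> \<dots> \<ge> \<lambda>\<^sub>m\<close> is the list of its \<open>m\<close> parts, zero parts included, so that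
  \<open>\<lambda>\<^sub>i\<close> is the list entry at position \<open>i - 1\<close>.\<close>

definition box_partitions :: "nat \<Rightarrow> nat \<Rightarrow> nat list set" where
  "box_partitions m n =
     {l. length l = m \<and> sorted_wrt (\<ge>) l \<and> (\<forall>p \<in> set l. p \<le> n)}"

definition box_poly :: "nat \<Rightarrow> nat \<Rightarrow> real poly" where
  "box_poly m n = (\<Sum>l \<in> box_partitions m n. \<Prod>i<m. [:real (l ! i), 1:])"

definition odd_set_partitions :: "'a set \<Rightarrow> nat \<Rightarrow> 'a set set set" where
  "odd_set_partitions A k =
     {P. partition_on A P \<and> card P = k \<and> (\<forall>B \<in> P. odd (card B))}"

end

(* Clearing denominators, 2^m B_{m,n}(-n/2) is the complete homogeneous symmetric polynomial h_m in
   the n + 1 weights -n, -n + 2, ..., n, so its generating function in m is the inverse of the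
   product of the factors 1 - (2i - n) X. Passing from n to n + 2 multiplies this product by
   1 - (n + 2)^2 X^2. Removing the block of one element shows that sinh^n / n! is the exponential
   generating function of T_{N,n} in N; since (sinh^n)'' = n (n - 1) sinh^(n-2) + n^2 sinh^n, one
   has T_{N+2,n+2} = T_{N,n} + (n + 2)^2 T_{N,n+2}, which is the same recurrence. *)

theory Submission
  imports Defs "HOL-Computational_Algebra.Formal_Power_Series"
begin

unbundle fps_syntax

section \<open>Hyperbolic sine and cosine as formal power series\<close>

definition fps_sinh :: "real fps" where
  "fps_sinh = fps_const (1/2) * (fps_exp 1 - fps_exp (- 1))"

definition fps_cosh :: "real fps" where
  "fps_cosh = fps_const (1/2) * (fps_exp 1 + fps_exp (- 1))"

lemma fps_nth_sinh_0 [simp]: "fps_sinh $ 0 = 0"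
  by (simp add: fps_sinh_def)

lemma fps_nth_cosh: "fps_cosh $ n = (if even n then 1 / fact n else 0)"
  by (simp add: fps_cosh_def)

lemma fps_deriv_sinh: "fps_deriv fps_sinh = fps_cosh"
  by (simp add: fps_sinh_def fps_cosh_def flip: fps_const_neg)

lemma fps_deriv_cosh: "fps_deriv fps_cosh = fps_sinh"
  by (simp add: fps_sinh_def fps_cosh_def flip: fps_const_neg)

lemma fps_cosh_square: "fps_cosh ^ 2 = 1 + fps_sinh ^ 2"
proof -
  have e: "fps_exp 1 * fps_exp (- 1) = (1 :: real fps)"
    by (simp flip: fps_exp_add_mult)
  have "fps_cosh ^ 2 = fps_sinh ^ 2 + fps_const (1/2) ^ 2 * 4 * (fps_exp 1 * fps_exp (- 1))"
    unfolding fps_cosh_def fps_sinh_def power_mult_distrib by algebra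
  also have "fps_const (1/2 :: real) ^ 2 * 4 = 1"
    by (simp add: numeral_fps_const power2_eq_square)
  finally show ?thesis by (simp add: e)
qed

section \<open>The series sinh^n / n! and its differential equation\<close>

definition fps_odd_blocks :: "nat \<Rightarrow> real fps" where
  "fps_odd_blocks n = fps_const (1 / fact n) * fps_sinh ^ n"

lemma fps_odd_blocks_0 [simp]: "fps_odd_blocks 0 = 1"
  by (simp add: fps_odd_blocks_def)

text \<open>Combinatorially this removes the block of a distinguished element: differentiation sets
  that element aside, and the remaining members of its block form a set of even size, which
  \<open>fps_cosh\<close> counts.\<close>

lemma fps_deriv_odd_blocks_Suc:
  "fps_deriv (fps_odd_blocks (Suc n)) = fps_cosh * fps_odd_blocks n"
proof -
  have "fps_const (1 / fact n :: real) = fps_const (1 / fact (Suc n)) * of_nat (Suc n)"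
    by (simp add: fps_of_nat [symmetric] field_simps del: of_nat_Suc)
  moreover have "fps_deriv (fps_sinh ^ Suc n) = of_nat (Suc n) * fps_cosh * fps_sinh ^ n"
    by (simp only: fps_deriv_power' fps_deriv_sinh diff_Suc_1)
  ultimately show ?thesis
    by (simp only: fps_odd_blocks_def fps_deriv_mult_const_left fps_deriv_mult_const_right mult.assoc mult.commute mult.left_commute)
qed

lemma fps_sinh_mult_odd_blocks:
  "fps_sinh * fps_odd_blocks n = of_nat (Suc n) * fps_odd_blocks (Suc n)"
proof -
  have "fps_const (1 / fact n :: real) = of_nat (Suc n) * fps_const (1 / fact (Suc n))"
    by (simp add: fps_of_nat [symmetric] field_simps del: of_nat_Suc)
  then show ?thesis
    by (simp only: fps_odd_blocks_def power_Suc mult.assoc mult.commute mult.left_commute)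
qed

text \<open>After cosh^2 is replaced by 1 + sinh^2, each factor sinh is absorbed by raising the
  index. The two contributions n + 2 and (n + 1)(n + 2) to the top term add up to (n + 2)^2.\<close>

lemma fps_deriv2_odd_blocks:
  "fps_deriv (fps_deriv (fps_odd_blocks (Suc (Suc n)))) =
     fps_odd_blocks n + of_nat ((n + 2)\<^sup>2) * fps_odd_blocks (Suc (Suc n))"
proof -
  have "fps_deriv (fps_deriv (fps_odd_blocks (Suc (Suc n)))) =
        fps_sinh * fps_odd_blocks (Suc n) + fps_cosh\<^sup>2 * fps_odd_blocks n"
    by (simp add: fps_deriv_odd_blocks_Suc fps_deriv_cosh power2_eq_square algebra_simps)
  also have "fps_cosh\<^sup>2 * fps_odd_blocks n =
             fps_odd_blocks n + fps_sinh * (fps_sinh * fps_odd_blocks n)"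
    unfolding fps_cosh_square by (simp add: power2_eq_square algebra_simps)
  also have "\<dots> = fps_odd_blocks n + of_nat (Suc n) * (fps_sinh * fps_odd_blocks (Suc n))"
    by (simp add: fps_sinh_mult_odd_blocks mult_ac)
  also have "fps_sinh * fps_odd_blocks (Suc n) = of_nat (Suc (Suc n)) * fps_odd_blocks (Suc (Suc n))"
    by (rule fps_sinh_mult_odd_blocks)
  finally show ?thesis
    by (simp add: power2_eq_square algebra_simps)
qed

lemma fps_nth_odd_blocks_less:
  assumes "k < n" shows "fps_odd_blocks n $ k = 0"
  using assms startsby_zero_power_prefix [of fps_sinh n] by (simp add: fps_odd_blocks_def)

section \<open>Counting partitions into blocks of odd size\<close>

lemma sum_even_subsets:
  fixes g :: "nat \<Rightarrow> real"
  assumes "finite A"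
  shows "(\<Sum>X | X \<subseteq> A \<and> even (card X). g (card X)) =
         (\<Sum>j\<le>card A. if even j then real (card A choose j) * g j else 0)"
proof -
  have "(\<Sum>X | X \<subseteq> A \<and> even (card X). g (card X)) =
        (\<Sum>X \<in> Pow A. if even (card X) then g (card X) else 0)"
    using assms by (simp add: sum.inter_filter [symmetric])
  also have "\<dots> = (\<Sum>j\<le>card A. \<Sum>X \<in> {X \<in> Pow A. card X = j}. if even (card X) then g (card X) else 0)"
    using assms by (intro sum.group [symmetric]) (auto intro: card_mono)
  also have "\<dots> = (\<Sum>j\<le>card A. real (card {X. X \<subseteq> A \<and> card X = j}) * (if even j then g j else 0))"
    by (intro sum.cong) auto
  finally show ?thesis using assms by (simp add: n_subsets if_distrib cong: if_cong)
qed

text \<open>Partitions are classified by the block that contains \<open>a\<close>. The set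
  \<open>X\<close> of its other members has even size, and the remaining blocks form an arbitrary
  partition of \<open>A - X\<close> into \<open>n\<close> odd blocks.\<close>

lemma card_odd_set_partitions_insert:
  assumes "finite A" "a \<notin> A"
  shows "card (odd_set_partitions (insert a A) (Suc n)) =
         (\<Sum>X | X \<subseteq> A \<and> even (card X). card (odd_set_partitions (A - X) n))"
proof -
  let ?I = "{X. X \<subseteq> A \<and> even (card X)}"
  let ?f = "\<lambda>(X, P). insert (insert a X) P"
  \<comment> \<open>The blocks of \<open>P\<close> avoid \<open>a\<close>, so the added block is
    new: hence the block count rises by exactly one, and \<open>P\<close> can be recovered from the
    image.\<close>
  have a_notin: "insert a X \<notin> P" if "P \<in> odd_set_partitions (A - X) n" for X P
    using that assms by (auto simp: odd_set_partitions_def partition_on_def)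
  have "bij_betw ?f (SIGMA X:?I. odd_set_partitions (A - X) n)
          (odd_set_partitions (insert a A) (Suc n))"
    unfolding bij_betw_def
  proof (intro conjI subset_antisym subsetI)
    show "inj_on ?f (SIGMA X:?I. odd_set_partitions (A - X) n)"
    proof (rule inj_onI, clarsimp)
      fix X P Y Q
      assume X: "X \<subseteq> A" "P \<in> odd_set_partitions (A - X) n"
        and Y: "Y \<subseteq> A" "Q \<in> odd_set_partitions (A - Y) n"
        and eq: "insert (insert a X) P = insert (insert a Y) Q"
      \<comment> \<open>Only one block of the image contains \<open>a\<close>, so the image
        determines \<open>X\<close>.\<close>
      have "B = insert a X" if "a \<in> B" "B \<in> insert (insert a X) P" for B
        using that X assms by (auto simp: odd_set_partitions_def partition_on_def)
      then have "insert a Y = insert a X" using eq by (metis insertI1)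
      then have "X = Y" using X Y assms by (metis insert_ident subsetD)
      moreover have "P = Q"
        using eq a_notin X Y \<open>X = Y\<close> by (metis insert_ident)
      ultimately show "X = Y \<and> P = Q" ..
    qed
  next
    fix R assume "R \<in> ?f ` (SIGMA X:?I. odd_set_partitions (A - X) n)"
    then obtain X P where X: "X \<subseteq> A" "even (card X)"
      and P: "P \<in> odd_set_partitions (A - X) n" and R: "R = insert (insert a X) P"
      by auto
    have fin: "finite X" "a \<notin> X" using X assms by (auto intro: finite_subset)
    have part: "partition_on (A - X) P" using P by (simp add: odd_set_partitions_def)
    have "disjnt (insert a X) (\<Union>P)"
      using part assms X by (auto simp: partition_on_def disjnt_def)
    moreover have "insert a A - insert a X = A - X" using assms by auto
    ultimately have "partition_on (insert a A) R"
      using part X unfolding R by (subst partition_on_insert) auto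
    moreover have "finite P" using part assms by (auto intro: finite_elements)
    ultimately show "R \<in> odd_set_partitions (insert a A) (Suc n)"
      using P X fin a_notin [OF P] by (auto simp: R odd_set_partitions_def)
  next
    fix R assume "R \<in> odd_set_partitions (insert a A) (Suc n)"
    then have R: "partition_on (insert a A) R" "card R = Suc n" "\<And>B. B \<in> R \<Longrightarrow> odd (card B)"
      by (auto simp: odd_set_partitions_def)
    then obtain B where B: "a \<in> B" "B \<in> R" by (auto simp: partition_on_def)
    \<comment> \<open>The preimage of \<open>R\<close> is found by splitting off the block of
      \<open>a\<close>.\<close>
    define X P where "X = B - {a}" and "P = R - {B}"
    have RBP: "R = insert B P" "B = insert a X" "a \<notin> X" "B \<notin> P" using B by (auto simp: X_def P_def)
    have "finite R" using R assms by (auto intro: finite_elements)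
    then have "card P = n" using R RBP by simp
    have "B \<subseteq> insert a A" using R B by (auto simp: partition_on_def)
    then have "X \<subseteq> A" by (auto simp: X_def)
    then have "finite X" using assms by (auto intro: finite_subset)
    then have "even (card X)" using R(3) [OF B(2)] RBP by simp
    have "disjnt B (\<Union>P)"
      using R RBP by (auto simp: partition_on_def disjnt_def pairwise_insert)
    then have "partition_on (insert a A - B) P"
      using R(1) RBP(1) partition_on_insert by metis
    moreover have "insert a A - B = A - X" using RBP assms by auto
    ultimately have "P \<in> odd_set_partitions (A - X) n"
      using R RBP \<open>card P = n\<close> by (simp add: odd_set_partitions_def)
    with \<open>X \<subseteq> A\<close> \<open>even (card X)\<close> show "R \<in> ?f ` (SIGMA X:?I. odd_set_partitions (A - X) n)"
      by (force simp: RBP intro!: image_eqI [where x = "(X, P)"])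
  qed
  moreover have "finite (odd_set_partitions (A - X) n)" for X
    using finitely_many_partition_on [of "A - X"] assms
    by (auto simp: odd_set_partitions_def intro: finite_subset [rotated])
  ultimately show ?thesis
    using assms by (simp flip: bij_betw_same_card)
qed

lemma odd_set_partitions_0:
  assumes "finite A"
  shows "odd_set_partitions A 0 = (if A = {} then {{}} else {})"
proof -
  have "P = {}" if "partition_on A P" "card P = 0" for P
    using that finite_elements [OF assms] by auto
  then show ?thesis
    by (auto simp: odd_set_partitions_def partition_on_def)
qed

lemma odd_set_partitions_empty_Suc: "odd_set_partitions {} (Suc n) = {}"
  by (auto simp: odd_set_partitions_def partition_on_empty)

text \<open>Splitting off the block of one element reduces the number of blocks but leaves varying
  subsets, so the induction on \<open>n\<close> keeps \<open>A\<close> arbitrary. The resulting sum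
  over block sizes is a Cauchy product with \<open>fps_cosh\<close>.\<close>

lemma card_odd_set_partitions:
  assumes "finite A"
  shows "real (card (odd_set_partitions A n)) = fact (card A) * fps_odd_blocks n $ card A"
  using assms
proof (induction n arbitrary: A)
  case 0
  then show ?case by (auto simp: odd_set_partitions_0)
next
  case (Suc n)
  show ?case
  proof (cases "A = {}")
    case True
    then show ?thesis by (simp add: odd_set_partitions_empty_Suc fps_nth_odd_blocks_less)
  next
    case False
    then obtain a A' where A: "A = insert a A'" "a \<notin> A'"
      by (meson ex_in_conv mk_disjoint_insert)
    let ?N = "card A'"
    have fin: "finite A'" and N: "card A = Suc ?N" using A Suc.prems by auto
    have "real (card (odd_set_partitions A (Suc n))) =
          (\<Sum>X | X \<subseteq> A' \<and> even (card X). real (card (odd_set_partitions (A' - X) n)))"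
      using A fin by (simp add: card_odd_set_partitions_insert)
    also have "\<dots> = (\<Sum>X | X \<subseteq> A' \<and> even (card X). 
                 fact (?N - card X) * fps_odd_blocks n $ (?N - card X))"
      using fin by (intro sum.cong) (auto simp: Suc.IH card_Diff_subset finite_subset)
    also have "\<dots> = (\<Sum>j\<le>?N. if even j
         then real (?N choose j) * (fact (?N - j) * fps_odd_blocks n $ (?N - j)) else 0)"
      by (rule sum_even_subsets [OF fin])
    \<comment> \<open>Here (N choose j) (N - j)! = N! / j!, and 1 / j! for even j, 0 otherwise, is
      the coefficient of cosh.\<close>
    also have "\<dots> = fact ?N * (\<Sum>j\<le>?N. fps_cosh $ j * fps_odd_blocks n $ (?N - j))"
      unfolding sum_distrib_left
      by (intro sum.cong) (auto simp: fps_nth_cosh binomial_fact)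
    also have "\<dots> = fact ?N * fps_deriv (fps_odd_blocks (Suc n)) $ ?N"
      by (simp add: fps_deriv_odd_blocks_Suc fps_mult_nth atLeast0AtMost)
    also have "\<dots> = fact (card A) * fps_odd_blocks (Suc n) $ card A"
      by (simp add: N)
    finally show ?thesis .
  qed
qed

section \<open>Box sums as complete homogeneous symmetric polynomials in \<open>x 0\<close>, ...,
  \<open>x n\<close>\<close>

definition box_sum :: "(nat \<Rightarrow> 'a::comm_ring_1) \<Rightarrow> nat \<Rightarrow> nat \<Rightarrow> 'a" where
  "box_sum x m n = (\<Sum>l \<in> box_partitions m n. \<Prod>p\<leftarrow>l. x p)"

lemma finite_box_partitions: "finite (box_partitions m n)"
  by (rule finite_subset [OF _ finite_lists_length_eq [of "{..n}" m]])
     (auto simp: box_partitions_def)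

lemma box_partitions_0: "box_partitions 0 n = {[]}"
  by (auto simp: box_partitions_def)

lemma box_partitions_Suc_0:
  "box_partitions (Suc m) 0 = (#) 0 ` box_partitions m 0"
  by (auto simp: box_partitions_def length_Suc_conv image_iff)

text \<open>The head of a decreasing list is its largest part. Either it equals
  \<open>Suc n\<close>, and the tail is subject to the same bound, or every part is at most
  \<open>n\<close>.\<close>

lemma box_partitions_Suc_Suc:
  "box_partitions (Suc m) (Suc n) =
     (#) (Suc n) ` box_partitions m (Suc n) \<union> box_partitions (Suc m) n"
  by (auto simp: box_partitions_def length_Suc_conv image_iff le_Suc_eq) (meson le_trans)

lemma box_sum_0 [simp]: "box_sum x 0 n = 1"
  by (simp add: box_sum_def box_partitions_0)

lemma box_sum_Suc_0: "box_sum x (Suc m) 0 = x 0 * box_sum x m 0"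
  by (simp add: box_sum_def box_partitions_Suc_0 sum.reindex sum_distrib_left)

lemma box_sum_Suc_Suc:
  "box_sum x (Suc m) (Suc n) = x (Suc n) * box_sum x m (Suc n) + box_sum x (Suc m) n"
proof -
  have "(#) (Suc n) ` box_partitions m (Suc n) \<inter> box_partitions (Suc m) n = {}"
    by (auto simp: box_partitions_def)
  then show ?thesis
    by (simp add: box_sum_def box_partitions_Suc_Suc sum.union_disjoint finite_box_partitions
          sum.reindex sum_distrib_left)
qed

text \<open>By the recurrence for box sums, the factor with weight \<open>x (Suc n)\<close> turns
  the series for \<open>Suc n\<close> into the series for \<open>n\<close>, so the factors can be
  cancelled one at a time.\<close>

lemma fps_box_sum_mult_prod:
  "Abs_fps (\<lambda>m. box_sum x m n) * (\<Prod>i\<le>n. 1 - fps_const (x i) * fps_X) = 1"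
proof (induction n)
  case 0
  have "Abs_fps (\<lambda>m. box_sum x m 0) * (1 - fps_const (x 0) * fps_X) = 1"
  proof (rule fps_ext)
    fix m show "(Abs_fps (\<lambda>m. box_sum x m 0) * (1 - fps_const (x 0) * fps_X)) $ m = 1 $ m"
      by (cases m) (simp_all add: algebra_simps box_sum_Suc_0)
  qed
  then show ?case by simp
next
  case (Suc n)
  have "Abs_fps (\<lambda>m. box_sum x m (Suc n)) * (1 - fps_const (x (Suc n)) * fps_X) =
        Abs_fps (\<lambda>m. box_sum x m n)"
  proof (rule fps_ext)
    fix m show "(Abs_fps (\<lambda>m. box_sum x m (Suc n)) * (1 - fps_const (x (Suc n)) * fps_X)) $ m =
                Abs_fps (\<lambda>m. box_sum x m n) $ m"
      by (cases m) (simp_all add: algebra_simps box_sum_Suc_Suc)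
  qed
  then have "Abs_fps (\<lambda>m. box_sum x m (Suc n)) * ((1 - fps_const (x (Suc n)) * fps_X) *
               (\<Prod>i\<le>n. 1 - fps_const (x i) * fps_X)) = 1"
    by (simp only: Suc.IH flip: mult.assoc)
  then show ?case by (simp only: prod.atMost_Suc mult.commute)
qed

text \<open>The power 2^m supplies a factor 2 to each of the m parts, turning p - n/2 into the
  weight 2p - n.\<close>

lemma box_poly_eq_box_sum:
  "2 ^ m * poly (box_poly m n) (- real n / 2) = box_sum (\<lambda>i. 2 * real i - real n) m n"
proof -
  have "2 ^ m * (\<Prod>i<m. - (real n / 2) + real (l ! i)) = (\<Prod>p\<leftarrow>l. 2 * real p - real n)"
    if "l \<in> box_partitions m n" for l
  proof -
    have l: "length l = m" using that by (simp add: box_partitions_def)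
    have "2 ^ m * (\<Prod>i<m. - (real n / 2) + real (l ! i)) = 
          (\<Prod>i<m. 2 * (- (real n / 2) + real (l ! i)))"
      by (simp only: prod.distrib prod_constant card_lessThan)
    also have "\<dots> = (\<Prod>i<m. 2 * real (l ! i) - real n)"
      by (intro prod.cong) (auto simp: field_simps)
    finally show ?thesis
      by (simp add: l prod.list_conv_set_nth atLeast0LessThan)
  qed
  then show ?thesis
    by (simp add: box_poly_def box_sum_def poly_sum poly_prod sum_distrib_left add.commute)
qed

section \<open>The common recurrence from n to n + 2\<close>

lemma prod_symmetric_weights:
  "(\<Prod>i\<le>Suc (Suc n). 1 - fps_const (2 * real i - real (Suc (Suc n))) * fps_X) =
   (\<Prod>i\<le>n. 1 - fps_const (2 * real i - real n) * fps_X) * (1 - of_nat ((n + 2)\<^sup>2) * fps_X\<^sup>2)"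
proof -
  define c where "c = fps_const (real (n + 2))"
  have c: "of_nat ((n + 2)\<^sup>2) = c * c"
    by (simp only: c_def fps_of_nat [symmetric] power2_eq_square of_nat_mult fps_const_mult)
  have "(\<Prod>i\<le>Suc (Suc n). 1 - fps_const (2 * real i - real (Suc (Suc n))) * fps_X) =
        (1 + c * fps_X) * (\<Prod>i\<le>n. 1 - fps_const (2 * real i - real n) * fps_X) * (1 - c * fps_X)"
  proof -
    have first: "fps_const (2 * real 0 - real (Suc (Suc n))) = - c"
      by (simp add: c_def)
    \<comment> \<open>This is the weight at the top index \<open>Suc (Suc n)\<close>, in the form to
      which \<open>inner\<close> rewrites it.\<close>
    have last: "fps_const (2 * real (Suc n) - real n) = c"
      by (simp add: c_def add.commute)
    have inner: "2 * real (Suc i) - real (Suc (Suc n)) = 2 * real i - real n" for i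
      by simp
    show ?thesis
      unfolding prod.atMost_Suc_shift [of _ n] prod.atMost_Suc [of _ "Suc n"] first last inner
      by (simp only: mult_minus_left diff_minus_eq_add)
  qed
  also have "\<dots> = (\<Prod>i\<le>n. 1 - fps_const (2 * real i - real n) * fps_X) * (1 - c * c * fps_X\<^sup>2)"
    by (simp add: power2_eq_square algebra_simps)
  finally show ?thesis by (simp only: c)
qed

text \<open>Multiplication by 1 - (n + 2)^2 X^2 subtracts (n + 2)^2 times coefficient m - 2 from
  coefficient m. Comparing coefficients thus gives the recurrence from the second derivative, taken
  at N = m + n.\<close>

lemma fps_odd_blocks_coeff_recurrence:
  "Abs_fps (\<lambda>m. fact (m + Suc (Suc n)) * fps_odd_blocks (Suc (Suc n)) $ (m + Suc (Suc n))) *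
     (1 - of_nat ((n + 2)\<^sup>2) * fps_X\<^sup>2) =
   Abs_fps (\<lambda>m. fact (m + n) * fps_odd_blocks n $ (m + n))"
  (is "?Q * _ = _")
proof (rule fps_ext)
  fix m
  let ?c = "real ((n + 2)\<^sup>2)"
  have rec: "fact (N + 2) * fps_odd_blocks (Suc (Suc n)) $ (N + 2) =
             fact N * fps_odd_blocks n $ N + ?c * (fact N * fps_odd_blocks (Suc (Suc n)) $ N)" for N
  proof -
    have "fact (N + 2) * fps_odd_blocks (Suc (Suc n)) $ (N + 2) =
          fact N * fps_deriv (fps_deriv (fps_odd_blocks (Suc (Suc n)))) $ N"
      by (simp add: algebra_simps)
    also have "\<dots> = fact N * (fps_odd_blocks n $ N + ?c * fps_odd_blocks (Suc (Suc n)) $ N)"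
      unfolding fps_deriv2_odd_blocks by (simp only: fps_add_nth fps_of_nat [symmetric] fps_mult_left_const_nth)
    finally show ?thesis by (simp only: algebra_simps)
  qed
  have "(?Q * (1 - of_nat ((n + 2)\<^sup>2) * fps_X\<^sup>2)) $ m =
        (?Q - fps_const ?c * (fps_X\<^sup>2 * ?Q)) $ m"
    by (simp only: fps_of_nat [symmetric] algebra_simps mult_1_left)
  also have "\<dots> = ?Q $ m - ?c * (if m < 2 then 0 else ?Q $ (m - 2))"
    by (simp only: fps_sub_nth fps_mult_left_const_nth fps_X_power_mult_nth)
  \<comment> \<open>For m < 2 the right-hand side vanishes too: the degree m + n is below n + 2,
    where the series starts.\<close>
  also have "(if m < 2 then 0 else ?Q $ (m - 2)) = fact (m + n) * fps_odd_blocks (Suc (Suc n)) $ (m + n)"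
  proof (cases "m < 2")
    case False
    then have "m - 2 + Suc (Suc n) = m + n" by simp
    with False show ?thesis by (simp only: fps_nth_Abs_fps if_False)
  qed (simp add: fps_nth_odd_blocks_less)
  finally show "(?Q * (1 - of_nat ((n + 2)\<^sup>2) * fps_X\<^sup>2)) $ m =
             Abs_fps (\<lambda>m. fact (m + n) * fps_odd_blocks n $ (m + n)) $ m"
    using rec [of "m + n"] by (simp add: numeral_2_eq_2)
qed

text \<open>The recurrence moves n by two, so the induction has two base cases. For n = 0 the only
  weight is 0 and both factors are 1; for n = 1 the weights are -1 and 1, and the series is the
  geometric series in X^2.\<close>

lemma fps_odd_blocks_coeff_mult_prod:
  "Abs_fps (\<lambda>m. fact (m + n) * fps_odd_blocks n $ (m + n)) *
     (\<Prod>i\<le>n. 1 - fps_const (2 * real i - real n) * fps_X) = 1"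
proof (induction n rule: induct_nat_012)
  case 0
  show ?case by (rule fps_ext) simp
next
  case 1
  have "fps_odd_blocks (Suc 0) = fps_sinh" by (simp add: fps_odd_blocks_def)
  moreover have "(\<Prod>i\<le>Suc 0. 1 - fps_const (2 * real i - real (Suc 0)) * fps_X) = 1 - fps_X\<^sup>2"
    by (simp add: power2_eq_square algebra_simps flip: fps_const_neg)
  \<comment> \<open>The series sinh has only odd coefficients; the shift by one makes them the even
    ones.\<close>
  moreover have "fact (m + Suc 0) * fps_sinh $ (m + Suc 0) = (if even m then 1 else 0)" for m
    by (simp add: fps_sinh_def del: fact_Suc)
  moreover have "Abs_fps (\<lambda>m. if even m then 1 else 0) * (1 - fps_X\<^sup>2) = (1 :: real fps)"
    by (rule fps_ext) (auto simp: algebra_simps fps_X_power_mult_nth less_2_cases_iff)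
  ultimately show ?case by simp
next
  case (ge2 n)
  let ?p = "\<Prod>i\<le>n. 1 - fps_const (2 * real i - real n) * fps_X"
  let ?Q = "Abs_fps (\<lambda>m. fact (m + Suc (Suc n)) * fps_odd_blocks (Suc (Suc n)) $ (m + Suc (Suc n)))"
  have "?Q * (?p * (1 - of_nat ((n + 2)\<^sup>2) * fps_X\<^sup>2)) =
        ?Q * (1 - of_nat ((n + 2)\<^sup>2) * fps_X\<^sup>2) * ?p"
    by (simp only: mult.assoc mult.commute mult.left_commute)
  also have "\<dots> = 1"
    unfolding fps_odd_blocks_coeff_recurrence by (rule ge2.IH(1))
  finally show ?case by (simp only: prod_symmetric_weights)
qed

theorem proposition4p3:
  fixes m n :: nat and A :: "'a set"
  assumes "finite A" and "card A = m + n"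
  shows "2 ^ m * poly (box_poly m n) (- real n / 2) = real (card (odd_set_partitions A n))"
proof -
  let ?p = "\<Prod>i\<le>n. 1 - fps_const (2 * real i - real n) * fps_X"
  let ?H = "Abs_fps (\<lambda>m. box_sum (\<lambda>i. 2 * real i - real n) m n)"
  let ?T = "Abs_fps (\<lambda>m. fact (m + n) * fps_odd_blocks n $ (m + n))"
  \<comment> \<open>Both \<open>?H\<close> and \<open>?T\<close> are inverse to \<open>?p\<close>,
    and inverses in a commutative ring are unique.\<close>
  have "?H = ?H * (?T * ?p)"
    by (simp only: fps_odd_blocks_coeff_mult_prod mult_1_right)
  also have "\<dots> = ?H * ?p * ?T"
    by (simp only: mult.assoc mult.commute mult.left_commute)
  also have "\<dots> = ?T"
    by (simp only: fps_box_sum_mult_prod mult_1_left)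
  finally have "?H $ m = ?T $ m" by (rule arg_cong)
  then have "box_sum (\<lambda>i. 2 * real i - real n) m n = fact (m + n) * fps_odd_blocks n $ (m + n)"
    by (simp only: fps_nth_Abs_fps)
  then show ?thesis
    by (simp only: box_poly_eq_box_sum card_odd_set_partitions [OF assms(1)] assms(2))
qed

end
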